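(* Let $T$ be an $n\times n$ Hermitian (complex) matrix with $0$ diagonal. For any $\varepsilon\in(0,1)$ there exists $\sigma\subset\{1,\dots,n\}$ of size $$|\sigma|\geq\frac{(\sqrt2-1)^4\varepsilon^2n}{2}$$ such that $$\left\|P_\sigma TP_\sigma^*\right\|\leq\varepsilon\|T\|.$$
   Context: For $\sigma\subset\{1,\dots,n\}$, $P_\sigma:\mathbb{C}^n\to\mathbb{C}^\sigma$ is the canonical coordinate projection, so $P_\sigma TP_\sigma^*$ is the square submatrix of $T$ with rows and columns indexed by $\sigma$. $\|\cdot\|$ is the operator norm with respect to the Euclidean norms. *)

theory Defs
  imports
    "HOL-Analysis.L2_Norm"
    "Jordan_Normal_Form.Schur_Decomposition"
    "Jordan_Normal_Form.DL_Submatrix"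
begin

definition hermitian_mat :: "complex mat \<Rightarrow> bool" where
  "hermitian_mat A \<longleftrightarrow> mat_adjoint A = A"

definition vec_l2_norm :: "complex vec \<Rightarrow> real" where
  "vec_l2_norm v = L2_set (\<lambda>i. cmod (v $ i)) {..<dim_vec v}"

(* The supremum is over the closed unit ball rather than the unit sphere, so that it is taken over
   a nonempty set, and equals 0, also when A has no columns. *)
definition mat_op_norm :: "complex mat \<Rightarrow> real" where
  "mat_op_norm A = (SUP v \<in> {v \<in> carrier_vec (dim_col A). vec_l2_norm v \<le> 1}. vec_l2_norm (A *\<^sub>v v))"

(* The matrix of the coordinate projection from C^n to C^sigma, for a set sigma of indices below n.
   The coordinates of C^sigma are listed in increasing order of the indices. *)
definition coord_proj :: "nat \<Rightarrow> nat set \<Rightarrow> complex mat" where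
  "coord_proj n \<sigma> = mat (card \<sigma>) n (\<lambda>(i, j). if j = pick \<sigma> i then 1 else 0)"

lemma mat_adjoint_index:
  assumes "i < dim_col A" "j < dim_row A"
  shows "mat_adjoint A $$ (i, j) = conjugate (A $$ (j, i))"
  using assms by (simp add: mat_adjoint_def mat_of_rows_def)

lemma dim_mat_adjoint [simp]:
  "dim_row (mat_adjoint A) = dim_col A" "dim_col (mat_adjoint A) = dim_row A"
  by (simp_all add: mat_adjoint_def)

lemma compression_eq_submatrix:
  assumes T: "T \<in> carrier_mat n n" and \<sigma>: "\<sigma> \<subseteq> {..<n}"
  shows "coord_proj n \<sigma> * T * mat_adjoint (coord_proj n \<sigma>) = submatrix T \<sigma> \<sigma>"
proof -
  have fin: "finite \<sigma>" using \<sigma> finite_subset by blast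
  have eq: "{i. i < n \<and> i \<in> \<sigma>} = \<sigma>" using \<sigma> by auto
  have lt: "pick \<sigma> i < n" if "i < card \<sigma>" for i
    using pick_in_set_le[OF that] \<sigma> by auto
  have PT: "(coord_proj n \<sigma> * T) $$ (i, k) = T $$ (pick \<sigma> i, k)" if "i < card \<sigma>" "k < n" for i k
    using that T lt[OF that(1)]
    by (simp add: coord_proj_def scalar_prod_def if_distrib[of "\<lambda>x. x * _"] sum.delta cong: if_cong)
  show ?thesis
  proof (rule eq_matI)
    fix i j assume "i < dim_row (submatrix T \<sigma> \<sigma>)" "j < dim_col (submatrix T \<sigma> \<sigma>)"
    then have ij: "i < card \<sigma>" "j < card \<sigma>" using T by (simp_all add: dim_submatrix eq)
    have "(coord_proj n \<sigma> * T * mat_adjoint (coord_proj n \<sigma>)) $$ (i, j)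
        = (\<Sum>k = 0..<n. (coord_proj n \<sigma> * T) $$ (i, k) * mat_adjoint (coord_proj n \<sigma>) $$ (k, j))"
      using ij T by (simp add: coord_proj_def scalar_prod_def)
    also have "\<dots> = (\<Sum>k = 0..<n. if k = pick \<sigma> j then T $$ (pick \<sigma> i, k) else 0)"
    proof (rule sum.cong)
      fix k assume "k \<in> {0..<n}"
      then have k: "k < n" by simp
      then have "mat_adjoint (coord_proj n \<sigma>) $$ (k, j) = (if k = pick \<sigma> j then 1 else 0)"
        using ij by (simp add: mat_adjoint_index coord_proj_def)
      then show "(coord_proj n \<sigma> * T) $$ (i, k) * mat_adjoint (coord_proj n \<sigma>) $$ (k, j)
          = (if k = pick \<sigma> j then T $$ (pick \<sigma> i, k) else 0)"
        using PT[OF ij(1) k] by simp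
    qed simp
    also have "\<dots> = T $$ (pick \<sigma> i, pick \<sigma> j)"
      using lt[OF ij(2)] by simp
    also have "\<dots> = submatrix T \<sigma> \<sigma> $$ (i, j)"
      using ij T by (simp add: submatrix_index eq)
    finally show "(coord_proj n \<sigma> * T * mat_adjoint (coord_proj n \<sigma>)) $$ (i, j)
        = submatrix T \<sigma> \<sigma> $$ (i, j)" .
  qed (use T in \<open>simp_all add: coord_proj_def dim_submatrix eq\<close>)
qed

lemma vec_l2_norm_mult_le:
  assumes v: "v \<in> carrier_vec (dim_col A)"
  shows "vec_l2_norm (A *\<^sub>v v)
    \<le> (\<Sum>i<dim_row A. L2_set (\<lambda>j. cmod (A $$ (i, j))) {..<dim_col A}) * vec_l2_norm v"
proof -
  have "vec_l2_norm (A *\<^sub>v v) \<le> (\<Sum>i<dim_row A. cmod ((A *\<^sub>v v) $ i))"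
    unfolding vec_l2_norm_def using L2_set_le_sum[of "{..<dim_row A}" "\<lambda>i. cmod ((A *\<^sub>v v) $ i)"] by simp
  also have "\<dots> \<le> (\<Sum>i<dim_row A. L2_set (\<lambda>j. cmod (A $$ (i, j))) {..<dim_col A} * vec_l2_norm v)"
  proof (rule sum_mono)
    fix i assume "i \<in> {..<dim_row A}"
    then have "(A *\<^sub>v v) $ i = (\<Sum>j<dim_col A. A $$ (i, j) * v $ j)"
      using v by (simp add: scalar_prod_def atLeast0LessThan)
    then have "cmod ((A *\<^sub>v v) $ i) \<le> (\<Sum>j<dim_col A. \<bar>cmod (A $$ (i, j))\<bar> * \<bar>cmod (v $ j)\<bar>)"
      by (simp add: norm_mult sum_norm_le)
    also have "\<dots> \<le> L2_set (\<lambda>j. cmod (A $$ (i, j))) {..<dim_col A} * vec_l2_norm v"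
      unfolding vec_l2_norm_def using v L2_set_mult_ineq
      by (metis carrier_vecD)
    finally show "cmod ((A *\<^sub>v v) $ i)
      \<le> L2_set (\<lambda>j. cmod (A $$ (i, j))) {..<dim_col A} * vec_l2_norm v" .
  qed
  finally show ?thesis by (simp add: sum_distrib_right)
qed

lemma bdd_above_mat_op_norm:
  "bdd_above ((\<lambda>v. vec_l2_norm (A *\<^sub>v v)) ` {v \<in> carrier_vec (dim_col A). vec_l2_norm v \<le> 1})"
proof (rule bdd_aboveI2)
  let ?C = "\<Sum>i<dim_row A. L2_set (\<lambda>j. cmod (A $$ (i, j))) {..<dim_col A}"
  fix v assume "v \<in> {v \<in> carrier_vec (dim_col A). vec_l2_norm v \<le> 1}"
  then have v: "v \<in> carrier_vec (dim_col A)" "vec_l2_norm v \<le> 1" by auto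
  have "?C * vec_l2_norm v \<le> ?C"
    using v(2) by (intro mult_left_le sum_nonneg) (auto simp: L2_set_nonneg)
  with vec_l2_norm_mult_le[OF v(1)] show "vec_l2_norm (A *\<^sub>v v) \<le> ?C" by linarith
qed

end

theory Submission
  imports Defs
begin

text \<open>
The proof is a two-sided barrier argument in the style of Batson, Spielman and Srivastava, which
picks the indices of \<open>\<sigma>\<close> one at a time. Write \<open>M = \<parallel>T\<parallel>\<close>, and let \<open>T\<^sub>\<sigma>\<close> be the submatrix on the indices
chosen so far. The selection keeps the spectrum of \<open>T\<^sub>\<sigma>\<close> inside \<open>(- u, u)\<close> and controls the potential
\<open>tr (u - T\<^sub>\<sigma>)\<inverse> + tr (u + T\<^sub>\<sigma>)\<inverse>\<close>,
which is large when an eigenvalue is close to one of the two barriers.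

Since the diagonal of \<open>T\<close> is zero, adding the index \<open>i\<close> borders \<open>u - T\<^sub>\<sigma>\<close> by the column \<open>- t\<^sub>i\<close>,
where \<open>t\<^sub>i\<close> is the part of column \<open>i\<close> of \<open>T\<close> with rows in \<open>\<sigma>\<close>, and by the diagonal entry \<open>u\<close>. With \<open>G = (u - T\<^sub>\<sigma>)\<inverse>\<close>, the bordered matrix is positive definite if and only
if the Schur complement \<open>u - t\<^sub>i* G t\<^sub>i\<close> is positive, and the trace of the inverse grows by exactly
\<open>(1 + |G t\<^sub>i|\<^sup>2) / (u - t\<^sub>i* G t\<^sub>i)\<close>; the same holds for \<open>u + T\<^sub>\<sigma>\<close>. Because \<open>T\<close> has norm \<open>M\<close>, the sum of
\<open>t\<^sub>i* G t\<^sub>i\<close> over the free indices \<open>i\<close> is at most \<open>M\<^sup>2 tr G\<close>, and that of \<open>|G t\<^sub>i|\<^sup>2\<close> is at most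
\<open>M\<^sup>2 tr (G\<^sup>2)\<close>. The latter trace can be much larger than the potential, so before each choice the
barrier moves outwards by a small \<open>\<delta>\<close>; this lowers the potential by at least \<open>\<delta> tr (G\<^sup>2)\<close>,
with \<open>G\<close> taken at the new barrier (lemma \<open>trace_shift_decrease\<close>) and pays for the second sum. Averaging
over the free indices then gives one index that suits both barriers at once (lemma \<open>barrier_step\<close>).

When the barrier starts at \<open>\<epsilon> M / 2\<close>, each step costs a multiple of \<open>1 / (\<epsilon> M)\<close> in potential and a
multiple of \<open>M / (\<epsilon> n)\<close> in barrier position, so \<open>\<epsilon>\<^sup>2 n / 64\<close> steps are possible with the
barrier still below \<open>\<epsilon> M\<close> and the averaging still valid (lemma \<open>greedy_barrier\<close>). Finally
\<open>(sqrt 2 - 1)\<^sup>4 / 2 \<le> 1 / 64\<close>.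
\<close>

section \<open>Kernels, quadratic forms and inverses on a finite index set\<close>

text \<open>A matrix is a function of two indices, and a principal submatrix is the same function read on a
smaller finite index set \<open>S\<close>. So the set can grow by one index at a time without renumbering.\<close>

definition app :: "'a set \<Rightarrow> ('a \<Rightarrow> 'a \<Rightarrow> complex) \<Rightarrow> ('a \<Rightarrow> complex) \<Rightarrow> 'a \<Rightarrow> complex" where
  "app S A x i = (\<Sum>j\<in>S. A i j * x j)"

definition ip :: "'a set \<Rightarrow> ('a \<Rightarrow> complex) \<Rightarrow> ('a \<Rightarrow> complex) \<Rightarrow> complex" where
  "ip S x y = (\<Sum>i\<in>S. cnj (x i) * y i)"

definition sqnorm :: "'a set \<Rightarrow> ('a \<Rightarrow> complex) \<Rightarrow> real" where
  "sqnorm S x = (\<Sum>i\<in>S. (cmod (x i))\<^sup>2)"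

definition herm :: "('a \<Rightarrow> 'a \<Rightarrow> complex) \<Rightarrow> bool" where
  "herm A \<longleftrightarrow> (\<forall>i j. cnj (A i j) = A j i)"

definition pos_def :: "'a set \<Rightarrow> ('a \<Rightarrow> 'a \<Rightarrow> complex) \<Rightarrow> bool" where
  "pos_def S A \<longleftrightarrow> (\<forall>x. (\<exists>i\<in>S. x i \<noteq> 0) \<longrightarrow> 0 < Re (ip S x (app S A x)))"

text \<open>Column \<open>j\<close> of \<open>G\<close> solves \<open>A x = e\<^sub>j\<close> on \<open>S\<close>; the inverse is used through these linear systems.\<close>

definition inverse_on :: "'a set \<Rightarrow> ('a \<Rightarrow> 'a \<Rightarrow> complex) \<Rightarrow> ('a \<Rightarrow> 'a \<Rightarrow> complex) \<Rightarrow> bool" where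
  "inverse_on S A G \<longleftrightarrow> (\<forall>i\<in>S. \<forall>j\<in>S. app S A (\<lambda>k. G k j) i = (if i = j then 1 else 0))"

text \<open>A factorization \<open>G = \<Sum>\<^sub>k h\<^sub>k h\<^sub>k*\<close>: it witnesses that \<open>G\<close> is Hermitian and positive
semidefinite, and serves in place of a square root of \<open>G\<close>.\<close>

definition gram_on :: "'a set \<Rightarrow> ('a \<Rightarrow> 'a \<Rightarrow> complex) \<Rightarrow> ('a \<Rightarrow> 'a \<Rightarrow> complex) \<Rightarrow> bool" where
  "gram_on S h G \<longleftrightarrow> (\<forall>i\<in>S. \<forall>j\<in>S. G i j = (\<Sum>k\<in>S. h k i * cnj (h k j)))"

definition trace_on :: "'a set \<Rightarrow> ('a \<Rightarrow> 'a \<Rightarrow> complex) \<Rightarrow> real" where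
  "trace_on S G = (\<Sum>j\<in>S. Re (G j j))"

lemma cnj_mult_self: "cnj z * z = of_real ((cmod z)\<^sup>2)"
  by (metis complex_norm_square mult.commute)

lemma ip_self: "ip S x x = of_real (sqnorm S x)"
  by (simp add: ip_def sqnorm_def cnj_mult_self)

lemma sqnorm_nonneg: "0 \<le> sqnorm S x"
  by (simp add: sqnorm_def sum_nonneg)

lemma cnj_ip: "cnj (ip S x y) = ip S y x"
  by (simp add: ip_def mult.commute)

lemma ip_cong: "(\<And>i. i \<in> S \<Longrightarrow> x i = x' i) \<Longrightarrow> (\<And>i. i \<in> S \<Longrightarrow> y i = y' i) \<Longrightarrow> ip S x y = ip S x' y'"
  by (simp add: ip_def)

lemma ip_app_herm:
  assumes "herm A"
  shows "ip S x (app S A y) = ip S (app S A x) y"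
proof -
  have h: "cnj (A i j) = A j i" for i j
    using assms by (simp add: herm_def)
  have "ip S x (app S A y) = (\<Sum>i\<in>S. \<Sum>j\<in>S. cnj (x i) * A i j * y j)"
    by (simp add: ip_def app_def sum_distrib_left mult.assoc)
  also have "\<dots> = (\<Sum>j\<in>S. \<Sum>i\<in>S. cnj (x i) * A i j * y j)"
    by (rule sum.swap)
  also have "\<dots> = ip S (app S A x) y"
    by (simp add: ip_def app_def sum_distrib_left sum_distrib_right h mult_ac)
  finally show ?thesis .
qed

lemma gram_on_cnj:
  assumes "gram_on S h G" "i \<in> S" "j \<in> S"
  shows "cnj (G i j) = G j i"
  using assms by (simp add: gram_on_def mult.commute)

lemma pos_def_nonneg:
  assumes "pos_def S A"
  shows "0 \<le> Re (ip S x (app S A x))"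
proof (cases "\<exists>i\<in>S. x i \<noteq> 0")
  case True
  then show ?thesis using assms by (auto simp: pos_def_def less_imp_le)
next
  case False
  then have "ip S x (app S A x) = 0" by (simp add: ip_def)
  then show ?thesis by simp
qed

section \<open>Adding one index to a positive definite kernel\<close>

text \<open>Let \<open>A\<close> have the inverse \<open>G\<close> on \<open>S\<close>, and let \<open>t\<close> be the column of \<open>A\<close> at a new index \<open>i\<close>. The
vector \<open>w = e\<^sub>i - G t\<close> is the one that is \<open>A\<close>-orthogonal to all vectors supported on \<open>S\<close>, and its
\<open>A\<close>-square is the Schur complement \<open>s = A\<^sub>i\<^sub>i - t* G t\<close>. Hence the inverse on \<open>insert i S\<close> is the
rank-one update \<open>G + w w* / s\<close>.\<close>

definition border_vec ::
  "'a set \<Rightarrow> ('a \<Rightarrow> 'a \<Rightarrow> complex) \<Rightarrow> ('a \<Rightarrow> 'a \<Rightarrow> complex) \<Rightarrow> 'a \<Rightarrow> 'a \<Rightarrow> complex" where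
  "border_vec S A G i j = (if j = i then 1 else - app S G (\<lambda>k. A k i) j)"

definition schur_complement ::
  "'a set \<Rightarrow> ('a \<Rightarrow> 'a \<Rightarrow> complex) \<Rightarrow> ('a \<Rightarrow> 'a \<Rightarrow> complex) \<Rightarrow> 'a \<Rightarrow> real" where
  "schur_complement S A G i = Re (A i i) - Re (ip S (\<lambda>k. A k i) (app S G (\<lambda>k. A k i)))"

definition border_inv ::
  "'a set \<Rightarrow> ('a \<Rightarrow> 'a \<Rightarrow> complex) \<Rightarrow> ('a \<Rightarrow> 'a \<Rightarrow> complex) \<Rightarrow> 'a \<Rightarrow> 'a \<Rightarrow> 'a \<Rightarrow> complex" where
  "border_inv S A G i j k = (if j \<in> S \<and> k \<in> S then G j k else 0)
     + border_vec S A G i j * cnj (border_vec S A G i k) / of_real (schur_complement S A G i)"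

lemma gram_on_form:
  assumes "gram_on S h G"
  shows "ip S t (app S G t) = of_real (\<Sum>l\<in>S. (cmod (\<Sum>j\<in>S. cnj (t j) * h l j))\<^sup>2)"
proof -
  have "ip S t (app S G t) = (\<Sum>j\<in>S. \<Sum>k\<in>S. \<Sum>l\<in>S. cnj (t j) * h l j * (cnj (h l k) * t k))"
    unfolding ip_def app_def sum_distrib_left
    using assms by (intro sum.cong refl)
      (simp add: gram_on_def sum_distrib_left sum_distrib_right mult_ac)
  also have "\<dots> = (\<Sum>j\<in>S. \<Sum>l\<in>S. \<Sum>k\<in>S. cnj (t j) * h l j * (cnj (h l k) * t k))"
    by (intro sum.cong refl sum.swap)
  also have "\<dots> = (\<Sum>l\<in>S. \<Sum>j\<in>S. \<Sum>k\<in>S. cnj (t j) * h l j * (cnj (h l k) * t k))"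
    by (rule sum.swap)
  also have "\<dots> = (\<Sum>l\<in>S. (\<Sum>j\<in>S. cnj (t j) * h l j) * cnj (\<Sum>k\<in>S. cnj (t k) * h l k))"
    by (simp only: cnj_sum sum_product) (simp add: mult_ac)
  finally show ?thesis
    by (simp only: of_real_sum complex_norm_square)
qed

locale bordering =
  fixes S :: "'a set" and A G h :: "'a \<Rightarrow> 'a \<Rightarrow> complex" and i :: 'a
  assumes fin: "finite S" and i: "i \<notin> S"
    and herm: "herm A" and pd: "pos_def S A"
    and inv: "inverse_on S A G" and gram: "gram_on S h G"
begin

lemma cnjA: "cnj (A j k) = A k j"
  using herm by (simp add: herm_def)

lemma app_border_vec:
  assumes "j \<in> insert i S"
  shows "app (insert i S) A (border_vec S A G i) j = (if j = i then of_real (schur_complement S A G i) else 0)"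
proof -
  let ?t = "\<lambda>k. A k i"
  have split: "app (insert i S) A (border_vec S A G i) j = A j i - app S A (app S G ?t) j"
  proof -
    have "(\<Sum>k\<in>S. A j k * border_vec S A G i k) = (\<Sum>k\<in>S. - (A j k * app S G ?t k))"
      using i by (intro sum.cong refl) (auto simp: border_vec_def)
    moreover have "border_vec S A G i i = 1"
      by (simp add: border_vec_def)
    ultimately show ?thesis
      using fin i by (simp add: app_def[of _ A] sum_negf)
  qed
  show ?thesis
  proof (cases "j = i")
    case True
    have "app S A (app S G ?t) i = ip S ?t (app S G ?t)"
      by (simp add: app_def ip_def cnjA)
    moreover have "A i i = of_real (Re (A i i))"
      using cnjA[of i i] by (simp add: complex_eq_iff)
    moreover have "ip S ?t (app S G ?t) = of_real (Re (ip S ?t (app S G ?t)))"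
      by (simp add: gram_on_form[OF gram])
    ultimately show ?thesis
      using True split by (simp add: schur_complement_def)
  next
    case False
    then have j: "j \<in> S" using assms by simp
    have "app S A (app S G ?t) j = (\<Sum>l\<in>S. app S A (\<lambda>k. G k l) j * ?t l)"
      unfolding app_def sum_distrib_left sum_distrib_right
      by (subst sum.swap) (simp add: mult.assoc)
    also have "\<dots> = ?t j"
      using j inv fin by (simp add: inverse_on_def if_distrib[of "\<lambda>x. x * _"] cong: if_cong)
    finally show ?thesis using False split by simp
  qed
qed

text \<open>Completing the square: \<open>x = y + x\<^sub>i w\<close> with \<open>y\<close> supported on \<open>S\<close>, and the cross terms vanish by the
orthogonality of \<open>w\<close> to vectors supported on \<open>S\<close>.\<close>

lemma form_decomp:
  assumes "\<And>k. k \<in> S \<Longrightarrow> y k = x k - x i * border_vec S A G i k"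
  shows "Re (ip (insert i S) x (app (insert i S) A x))
    = Re (ip S y (app S A y)) + (cmod (x i))\<^sup>2 * schur_complement S A G i"
proof -
  let ?S = "insert i S" and ?w = "border_vec S A G i" and ?s = "schur_complement S A G i"
  define y' where "y' = (\<lambda>k. x k - x i * ?w k)"
  have y'i: "y' i = 0" by (simp add: y'_def border_vec_def)
  have appx: "app ?S A x j = app ?S A y' j + x i * app ?S A ?w j" for j
  proof -
    have "app ?S A x j = (\<Sum>k\<in>?S. A j k * y' k + x i * (A j k * ?w k))"
      unfolding app_def by (intro sum.cong refl) (simp add: y'_def algebra_simps)
    then show ?thesis by (simp only: sum.distrib sum_distrib_left app_def)
  qed
  have yw: "ip ?S y' (app ?S A ?w) = 0"
    unfolding ip_def using y'i by (intro sum.neutral) (auto simp: app_border_vec)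
  then have wy: "ip ?S ?w (app ?S A y') = 0"
    by (metis cnj_ip complex_cnj_zero herm ip_app_herm)
  have ww: "ip ?S ?w (app ?S A ?w) = of_real ?s"
  proof -
    have "ip ?S ?w (app ?S A ?w) = (\<Sum>k\<in>?S. if k = i then of_real ?s else 0)"
      unfolding ip_def by (intro sum.cong refl) (auto simp: app_border_vec border_vec_def)
    then show ?thesis using fin by simp
  qed
  have x: "x k = y' k + x i * ?w k" for k by (simp add: y'_def)
  have "ip ?S x (app ?S A x) = ip ?S y' (app ?S A y') + x i * ip ?S y' (app ?S A ?w)
      + cnj (x i) * ip ?S ?w (app ?S A y') + cnj (x i) * x i * ip ?S ?w (app ?S A ?w)"
  proof -
    have "ip ?S x (app ?S A x) = (\<Sum>k\<in>?S. cnj (y' k) * app ?S A y' k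
        + x i * (cnj (y' k) * app ?S A ?w k) + cnj (x i) * (cnj (?w k) * app ?S A y' k)
        + cnj (x i) * x i * (cnj (?w k) * app ?S A ?w k))"
      unfolding ip_def
    proof (intro sum.cong refl)
      fix k
      have "cnj (x k) = cnj (y' k) + cnj (x i) * cnj (?w k)"
        using x[of k] by (metis complex_cnj_add complex_cnj_mult)
      then show "cnj (x k) * app ?S A x k = cnj (y' k) * app ?S A y' k
        + x i * (cnj (y' k) * app ?S A ?w k) + cnj (x i) * (cnj (?w k) * app ?S A y' k)
        + cnj (x i) * x i * (cnj (?w k) * app ?S A ?w k)"
        unfolding appx[of k] by (simp add: algebra_simps)
    qed
    then show ?thesis by (simp only: sum.distrib sum_distrib_left ip_def)
  qed
  also have "\<dots> = ip ?S y' (app ?S A y') + of_real ((cmod (x i))\<^sup>2 * ?s)"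
    by (simp add: yw wy ww cnj_mult_self)
  also have "ip ?S y' (app ?S A y') = ip S y' (app S A y')"
    using fin i y'i by (simp add: ip_def app_def)
  also have "\<dots> = ip S y (app S A y)"
    using assms by (simp add: ip_def app_def y'_def)
  finally show ?thesis by simp
qed

lemma schur_complement_pos:
  assumes "pos_def (insert i S) A"
  shows "0 < schur_complement S A G i"
proof -
  have "0 < Re (ip (insert i S) (border_vec S A G i) (app (insert i S) A (border_vec S A G i)))"
    using assms unfolding pos_def_def by (auto simp: border_vec_def)
  also have "\<dots> = Re (ip S (\<lambda>_. 0) (app S A (\<lambda>_. 0))) + schur_complement S A G i"
    by (subst form_decomp[where y = "\<lambda>_. 0"]) (auto simp: border_vec_def)
  finally show ?thesis by (simp add: ip_def)
qed

lemma pos_def_insert: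
  assumes s: "0 < schur_complement S A G i"
  shows "pos_def (insert i S) A"
  unfolding pos_def_def
proof (intro allI impI)
  fix x assume x: "\<exists>k\<in>insert i S. x k \<noteq> (0::complex)"
  define y where "y = (\<lambda>k. x k - x i * border_vec S A G i k)"
  have eq: "Re (ip (insert i S) x (app (insert i S) A x))
    = Re (ip S y (app S A y)) + (cmod (x i))\<^sup>2 * schur_complement S A G i"
    by (rule form_decomp) (simp add: y_def)
  show "0 < Re (ip (insert i S) x (app (insert i S) A x))"
  proof (cases "x i = 0")
    case True
    then have "\<exists>k\<in>S. y k \<noteq> 0" using x by (auto simp: y_def)
    then show ?thesis using pd True by (simp add: eq pos_def_def)
  next
    case False
    then show ?thesis
      using pos_def_nonneg[OF pd, of y] s by (simp add: eq add_nonneg_pos)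
  qed
qed

lemma inverse_on_insert:
  assumes s: "0 < schur_complement S A G i"
  shows "inverse_on (insert i S) A (border_inv S A G i)"
  unfolding inverse_on_def
proof (intro ballI)
  fix l k assume l: "l \<in> insert i S" and k: "k \<in> insert i S"
  let ?w = "border_vec S A G i" and ?s = "complex_of_real (schur_complement S A G i)"
  have "app (insert i S) A (\<lambda>j. border_inv S A G i j k) l
      = (\<Sum>j\<in>insert i S. A l j * (if j \<in> S \<and> k \<in> S then G j k else 0))
        + app (insert i S) A ?w l * (cnj (?w k) / ?s)"
  proof -
    have "border_inv S A G i j k = (if j \<in> S \<and> k \<in> S then G j k else 0) + ?w j * (cnj (?w k) / ?s)" for j
      by (simp add: border_inv_def)
    then show ?thesis
      by (simp only: app_def distrib_left sum.distrib sum_distrib_right mult.assoc)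
  qed
  also have "(\<Sum>j\<in>insert i S. A l j * (if j \<in> S \<and> k \<in> S then G j k else 0))
      = (if k \<in> S then app S A (\<lambda>j. G j k) l else 0)"
    using fin i by (simp add: app_def)
  also have "app (insert i S) A ?w l * (cnj (?w k) / ?s) = (if l = i then cnj (?w k) else 0)"
    using s by (simp add: app_border_vec[OF l])
  also have "(if k \<in> S then app S A (\<lambda>j. G j k) l else 0) + (if l = i then cnj (?w k) else 0)
      = (if l = k then 1 else 0)"
  proof (cases "k = i")
    case True
    then show ?thesis using i by (simp add: border_vec_def)
  next
    case False
    then have kS: "k \<in> S" using k by simp
    show ?thesis
    proof (cases "l = i")
      case True
      have "cnj (?w k) = - app S A (\<lambda>j. G j k) i"
        using False kS by (simp add: border_vec_def app_def cnjA gram_on_cnj[OF gram] mult.commute)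
      then show ?thesis using True kS False by simp
    next
      case False
      then show ?thesis using l kS inv by (simp add: inverse_on_def)
    qed
  qed
  finally show "app (insert i S) A (\<lambda>j. border_inv S A G i j k) l = (if l = k then 1 else 0)" .
qed

text \<open>The rank-one update adds the vector \<open>w / sqrt s\<close> to the factorization.\<close>

lemma gram_on_insert:
  assumes s: "0 < schur_complement S A G i"
  shows "gram_on (insert i S)
    (\<lambda>k j. if k = i then border_vec S A G i j / of_real (sqrt (schur_complement S A G i))
           else if j = i then 0 else h k j) (border_inv S A G i)"
  unfolding gram_on_def
proof (intro ballI)
  fix j k assume j: "j \<in> insert i S" and k: "k \<in> insert i S"
  let ?w = "border_vec S A G i" and ?s = "schur_complement S A G i"
  have ss: "complex_of_real (sqrt ?s) * complex_of_real (sqrt ?s) = of_real ?s"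
    using s by (simp flip: of_real_mult)
  have "(\<Sum>l\<in>S. (if j = i then 0 else h l j) * cnj (if k = i then 0 else h l k))
      = (if j \<in> S \<and> k \<in> S then G j k else 0)"
    using j k i gram by (cases "j = i"; cases "k = i") (simp_all add: gram_on_def cong: if_cong)
  moreover have "(\<Sum>l\<in>S. (if l = i then ?w j / of_real (sqrt ?s) else if j = i then 0 else h l j) *
        cnj (if l = i then ?w k / of_real (sqrt ?s) else if k = i then 0 else h l k))
     = (\<Sum>l\<in>S. (if j = i then 0 else h l j) * cnj (if k = i then 0 else h l k))"
    using i by (intro sum.cong refl) auto
  ultimately show "border_inv S A G i j k
      = (\<Sum>l\<in>insert i S. (if l = i then ?w j / of_real (sqrt ?s) else if j = i then 0 else h l j) *
        cnj (if l = i then ?w k / of_real (sqrt ?s) else if k = i then 0 else h l k))"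
    using fin i by (simp add: border_inv_def ss)
qed

text \<open>The trace of the update is the squared norm of \<open>w = e\<^sub>i - G t\<close> divided by \<open>s\<close>. This is the exact
change of the barrier potential when an index is added.\<close>

lemma trace_on_insert:
  "trace_on (insert i S) (border_inv S A G i)
    = trace_on S G + (1 + sqnorm S (app S G (\<lambda>k. A k i))) / schur_complement S A G i"
proof -
  let ?w = "border_vec S A G i" and ?s = "schur_complement S A G i"
  have d: "Re (?w j * cnj (?w j) / complex_of_real ?s) = (cmod (?w j))\<^sup>2 / ?s" for j
    by (metis complex_norm_square Re_complex_of_real of_real_divide)
  have wS: "(cmod (?w j))\<^sup>2 = (cmod (app S G (\<lambda>k. A k i) j))\<^sup>2" if "j \<in> S" for j
    using that i by (auto simp: border_vec_def)
  have wi: "(cmod (?w i))\<^sup>2 = 1" by (simp add: border_vec_def)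
  have "trace_on (insert i S) (border_inv S A G i)
     = (cmod (?w i))\<^sup>2 / ?s + (\<Sum>j\<in>S. Re (G j j) + (cmod (?w j))\<^sup>2 / ?s)"
  proof -
    have "Re (border_inv S A G i j j) = (if j \<in> S then Re (G j j) else 0) + (cmod (?w j))\<^sup>2 / ?s" for j
      by (simp only: border_inv_def plus_complex.sel d) simp
    then show ?thesis using fin i by (simp add: trace_on_def)
  qed
  also have "(\<Sum>j\<in>S. Re (G j j) + (cmod (?w j))\<^sup>2 / ?s)
     = trace_on S G + sqnorm S (app S G (\<lambda>k. A k i)) / ?s"
    by (simp add: wS trace_on_def sqnorm_def sum.distrib sum_divide_distrib)
  finally show ?thesis
    using wi by (simp add: add_divide_distrib)
qed

end

lemma pos_def_subset:
  assumes "pos_def S A" "R \<subseteq> S" "finite S"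
  shows "pos_def R A"
  unfolding pos_def_def
proof (intro allI impI)
  fix x assume x: "\<exists>i\<in>R. x i \<noteq> (0::complex)"
  define y where "y = (\<lambda>i. if i \<in> R then x i else 0)"
  have "app S A y i = app R A x i" for i
    unfolding app_def using assms by (intro sum.mono_neutral_cong_right) (auto simp: y_def)
  then have "ip S y (app S A y) = ip R x (app R A x)"
    unfolding ip_def using assms by (intro sum.mono_neutral_cong_right) (auto simp: y_def)
  moreover have "\<exists>i\<in>S. y i \<noteq> 0" using x assms by (auto simp: y_def)
  ultimately show "0 < Re (ip R x (app R A x))"
    using assms(1) by (metis pos_def_def)
qed

text \<open>Building the inverse one index at a time also produces its factorization, which is the
inverse of a Cholesky factorization of \<open>A\<close>.\<close>

lemma pos_def_inverse_exists:
  assumes "finite S" "herm A" "pos_def S A"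
  shows "\<exists>G h. inverse_on S A G \<and> gram_on S h G"
  using assms
proof (induction S rule: finite_induct)
  case empty
  then show ?case by (simp add: inverse_on_def gram_on_def)
next
  case (insert i S)
  have pd: "pos_def S A"
    by (rule pos_def_subset[OF insert.prems(2)]) (use insert.hyps in auto)
  obtain G h where "inverse_on S A G" "gram_on S h G"
    using insert pd by blast
  then interpret bordering S A G h i
    using insert pd by unfold_locales auto
  show ?case
    using inverse_on_insert gram_on_insert schur_complement_pos[OF insert.prems(2)] by blast
qed


section \<open>Moving the barrier\<close>

definition shift :: "real \<Rightarrow> ('a \<Rightarrow> 'a \<Rightarrow> complex) \<Rightarrow> 'a \<Rightarrow> 'a \<Rightarrow> complex" where
  "shift u K i j = (if i = j then of_real u else 0) - K i j"

lemma herm_shift: "herm K \<Longrightarrow> herm (shift u K)"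
  by (auto simp: herm_def shift_def)

lemma app_shift:
  assumes "finite S" "i \<in> S"
  shows "app S (shift u K) x i = of_real u * x i - app S K x i"
  using assms by (simp add: app_def shift_def left_diff_distrib sum_subtractf
      if_distrib[of "\<lambda>c. c * _"] cong: if_cong)

lemma ip_app_shift:
  assumes "finite S"
  shows "ip S y (app S (shift u K) x) = of_real u * ip S y x - ip S y (app S K x)"
proof -
  have "ip S y (app S (shift u K) x) = (\<Sum>i\<in>S. of_real u * (cnj (y i) * x i) - cnj (y i) * app S K x i)"
    unfolding ip_def by (intro sum.cong refl) (simp add: app_shift[OF assms] algebra_simps)
  then show ?thesis by (simp add: ip_def sum_subtractf sum_distrib_left)
qed

lemma pos_def_shift_mono:
  assumes "finite S" "u \<le> v" "pos_def S (shift u K)"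
  shows "pos_def S (shift v K)"
  unfolding pos_def_def
proof (intro allI impI)
  fix x assume "\<exists>i\<in>S. x i \<noteq> (0::complex)"
  then have "0 < Re (ip S x (app S (shift u K) x))"
    using assms(3) by (simp add: pos_def_def)
  moreover have "u * sqnorm S x \<le> v * sqnorm S x"
    using assms(2) by (simp add: mult_right_mono sqnorm_nonneg)
  ultimately show "0 < Re (ip S x (app S (shift v K) x))"
    using assms(1) by (simp add: ip_app_shift ip_self)
qed

text \<open>For \<open>A \<le> B = A + d\<close> with \<open>d = v - u\<close>, the resolvent identity \<open>A\<inverse> - B\<inverse> = d B\<inverse> A\<inverse>\<close> and
\<open>A\<inverse> \<ge> B\<inverse>\<close> give \<open>tr A\<inverse> - tr B\<inverse> \<ge> d tr ((B\<inverse>)\<^sup>2)\<close>. So moving the barrier away by \<open>d\<close> frees an amount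
of potential that controls the trace of the squared inverse. The proof
compares the columns \<open>y\<close> of \<open>A\<inverse>\<close> and \<open>x\<close> of \<open>B\<inverse>\<close>, one at a time.\<close>

lemma trace_shift_decrease:
  assumes fin: "finite S" and herm: "herm K"
    and pd: "pos_def S (shift u K)"
    and G: "inverse_on S (shift u K) G" and H: "inverse_on S (shift v K) H" and uv: "u < v"
  shows "(v - u) * (\<Sum>j\<in>S. sqnorm S (\<lambda>k. H k j)) \<le> trace_on S G - trace_on S H"
proof -
  have "(v - u) * sqnorm S (\<lambda>k. H k j) \<le> Re (G j j) - Re (H j j)" if j: "j \<in> S" for j
  proof -
    define x y d where "x = (\<lambda>k. H k j)" and "y = (\<lambda>k. G k j)" and "d = v - u"
    have d: "d > 0" using uv by (simp add: d_def)
    have Ay: "app S (shift u K) y i = (if i = j then 1 else 0)" if "i \<in> S" for i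
      using G that j by (simp add: inverse_on_def y_def)
    have Bx: "app S (shift v K) x i = (if i = j then 1 else 0)" if "i \<in> S" for i
      using H that j by (simp add: inverse_on_def x_def)
    have BA: "app S (shift v K) z i = app S (shift u K) z i + of_real d * z i" if "i \<in> S" for z i
      by (simp add: app_shift fin that d_def algebra_simps)
    have Axy: "app S (shift u K) (\<lambda>k. x k - y k) i = - of_real d * x i" if "i \<in> S" for i
    proof -
      have "app S (shift u K) (\<lambda>k. x k - y k) i = app S (shift u K) x i - app S (shift u K) y i"
        by (simp add: app_def right_diff_distrib sum_subtractf)
      moreover have "app S (shift u K) x i = app S (shift v K) x i - of_real d * x i"
        by (simp only: BA[OF that] add_diff_cancel_right')
      ultimately show ?thesis by (simp add: Ay[OF that] Bx[OF that])
    qed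
    \<comment> \<open>Positivity of \<open>A\<close> at \<open>x - y\<close>, where \<open>A (x - y) = - d x\<close>, yields \<open>|x|\<^sup>2 \<le> Re \<langle>y, x\<rangle>\<close>.\<close>
    have "0 \<le> Re (ip S (\<lambda>k. x k - y k) (app S (shift u K) (\<lambda>k. x k - y k)))"
      by (rule pos_def_nonneg[OF pd])
    also have "ip S (\<lambda>k. x k - y k) (app S (shift u K) (\<lambda>k. x k - y k))
        = ip S (\<lambda>k. x k - y k) (\<lambda>i. - of_real d * x i)"
      by (intro ip_cong refl) (simp add: Axy)
    also have "\<dots> = of_real d * (ip S y x - ip S x x)"
      by (simp add: ip_def sum_distrib_left right_diff_distrib left_diff_distrib sum_subtractf
          sum_negf mult_ac)
    finally have "0 \<le> d * (Re (ip S y x) - sqnorm S x)"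
      by (simp add: ip_self)
    then have le: "sqnorm S x \<le> Re (ip S y x)"
      using d by (simp add: zero_le_mult_iff)
    \<comment> \<open>Both evaluations of \<open>\<langle>x, B y\<rangle>\<close> together give \<open>Re (y\<^sub>j - x\<^sub>j) = d Re \<langle>x, y\<rangle>\<close>.\<close>
    have "ip S x (app S (shift v K) y) = ip S (app S (shift v K) x) y"
      by (rule ip_app_herm[OF herm_shift[OF herm]])
    also have "\<dots> = ip S (\<lambda>i. if i = j then 1 else 0) y"
      by (intro ip_cong refl) (simp add: Bx)
    also have "\<dots> = y j"
      using fin j by (simp add: ip_def if_distrib[of cnj] if_distrib[of "\<lambda>c. c * _"] cong: if_cong)
    finally have 1: "ip S x (app S (shift v K) y) = y j" .
    have "ip S x (app S (shift v K) y) = ip S x (\<lambda>i. (if i = j then 1 else 0) + of_real d * y i)"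
      by (intro ip_cong refl) (simp add: BA Ay)
    also have "\<dots> = cnj (x j) + of_real d * ip S x y"
      using fin j by (simp add: ip_def distrib_left sum.distrib sum_distrib_left mult_ac
          if_distrib[of "\<lambda>c. _ * c"] cong: if_cong)
    finally have "y j = cnj (x j) + of_real d * ip S x y" using 1 by simp
    moreover have "Re (ip S x y) = Re (ip S y x)"
      by (metis cnj_ip complex_cnj(1) Re_complex_of_real cnj.simps(1))
    ultimately have "Re (y j) = Re (x j) + d * Re (ip S y x)" by simp
    then show ?thesis
      using le d by (simp add: x_def y_def d_def)
  qed
  then have "(\<Sum>j\<in>S. (v - u) * sqnorm S (\<lambda>k. H k j)) \<le> (\<Sum>j\<in>S. Re (G j j) - Re (H j j))"
    by (rule sum_mono)
  then show ?thesis by (simp add: trace_on_def sum_distrib_left sum_subtractf)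
qed

definition norm_le_on :: "'a set \<Rightarrow> ('a \<Rightarrow> 'a \<Rightarrow> complex) \<Rightarrow> real \<Rightarrow> bool" where
  "norm_le_on S K M \<longleftrightarrow> (\<forall>x. sqnorm S (app S K x) \<le> M\<^sup>2 * sqnorm S x)"

text \<open>Extend \<open>z\<close> by zero to \<open>I\<close>; the rows outside \<open>S\<close> see only part of the image.\<close>

lemma sqnorm_off_diagonal_le:
  assumes fin: "finite I" and sub: "S \<subseteq> I" and nb: "norm_le_on I K M"
  shows "sqnorm (I - S) (app S K z) \<le> M\<^sup>2 * sqnorm S z"
proof -
  define x where "x = (\<lambda>i. if i \<in> S then z i else 0)"
  have appx: "app I K x = app S K z"
    unfolding app_def using fin sub
    by (intro ext sum.mono_neutral_cong_right) (auto simp: x_def)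
  have "sqnorm I x = sqnorm S z"
    unfolding sqnorm_def using fin sub by (intro sum.mono_neutral_cong_right) (auto simp: x_def)
  moreover have "sqnorm (I - S) (app S K z) \<le> sqnorm I (app I K x)"
    unfolding appx sqnorm_def using fin by (intro sum_mono2) auto
  ultimately show ?thesis using nb unfolding norm_le_on_def by (metis order_trans)
qed

text \<open>With \<open>t\<^sub>i\<close> the column of \<open>K\<close> at \<open>i\<close>, restricted to \<open>S\<close>, the form \<open>t\<^sub>i* G t\<^sub>i\<close> is the sum of the
\<open>|(K h\<^sub>l)\<^sub>i|\<^sup>2\<close> over the vectors \<open>h\<^sub>l\<close> of the factorization of \<open>G\<close>. Summing over \<open>i\<close> first gives the
norms of the images \<open>K h\<^sub>l\<close>.\<close>

lemma sum_column_forms_le: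
  assumes fin: "finite I" and sub: "S \<subseteq> I" and nb: "norm_le_on I K M" and herm: "herm K"
    and gram: "gram_on S h G"
  shows "(\<Sum>i\<in>I - S. Re (ip S (\<lambda>k. K k i) (app S G (\<lambda>k. K k i)))) \<le> M\<^sup>2 * trace_on S G"
proof -
  have cK: "cnj (K i j) = K j i" for i j using herm by (simp add: herm_def)
  have "(\<Sum>i\<in>I - S. Re (ip S (\<lambda>k. K k i) (app S G (\<lambda>k. K k i))))
      = (\<Sum>i\<in>I - S. \<Sum>l\<in>S. (cmod (app S K (h l) i))\<^sup>2)"
    by (simp only: gram_on_form[OF gram] Re_complex_of_real cK app_def)
  also have "\<dots> = (\<Sum>l\<in>S. sqnorm (I - S) (app S K (h l)))"
    unfolding sqnorm_def by (rule sum.swap)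
  also have "\<dots> \<le> (\<Sum>l\<in>S. M\<^sup>2 * sqnorm S (h l))"
    by (intro sum_mono sqnorm_off_diagonal_le fin sub nb)
  also have "\<dots> = M\<^sup>2 * (\<Sum>l\<in>S. \<Sum>j\<in>S. (cmod (h l j))\<^sup>2)"
    by (simp add: sqnorm_def sum_distrib_left)
  also have "(\<Sum>l\<in>S. \<Sum>j\<in>S. (cmod (h l j))\<^sup>2) = (\<Sum>j\<in>S. \<Sum>l\<in>S. (cmod (h l j))\<^sup>2)"
    by (rule sum.swap)
  also have "\<dots> = trace_on S G"
    unfolding trace_on_def
  proof (intro sum.cong refl)
    fix j assume "j \<in> S"
    then have "G j j = of_real (\<Sum>l\<in>S. (cmod (h l j))\<^sup>2)"
      using gram by (simp only: gram_on_def of_real_sum complex_norm_square)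
    then show "(\<Sum>l\<in>S. (cmod (h l j))\<^sup>2) = Re (G j j)" by (simp del: of_real_sum)
  qed
  finally show ?thesis .
qed

text \<open>The same exchange of summations, now with the columns of \<open>G\<close> in place of the vectors \<open>h\<^sub>l\<close>.\<close>

lemma sum_column_images_le:
  assumes fin: "finite I" and sub: "S \<subseteq> I" and nb: "norm_le_on I K M" and herm: "herm K"
    and gram: "gram_on S h G"
  shows "(\<Sum>i\<in>I - S. sqnorm S (app S G (\<lambda>k. K k i))) \<le> M\<^sup>2 * (\<Sum>j\<in>S. sqnorm S (\<lambda>k. G k j))"
proof -
  have cK: "cnj (K i j) = K j i" for i j using herm by (simp add: herm_def)
  have eq: "cmod (app S G (\<lambda>k. K k i) j) = cmod (app S K (\<lambda>k. G k j) i)" if "j \<in> S" for i j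
  proof -
    have "cnj (app S G (\<lambda>k. K k i) j) = app S K (\<lambda>k. G k j) i"
      using that by (simp add: app_def cK gram_on_cnj[OF gram] mult.commute)
    then show ?thesis by (metis complex_mod_cnj)
  qed
  have "(\<Sum>i\<in>I - S. sqnorm S (app S G (\<lambda>k. K k i)))
      = (\<Sum>i\<in>I - S. \<Sum>j\<in>S. (cmod (app S K (\<lambda>k. G k j) i))\<^sup>2)"
    by (simp add: sqnorm_def eq)
  also have "\<dots> = (\<Sum>j\<in>S. sqnorm (I - S) (app S K (\<lambda>k. G k j)))"
    unfolding sqnorm_def by (rule sum.swap)
  also have "\<dots> \<le> (\<Sum>j\<in>S. M\<^sup>2 * sqnorm S (\<lambda>k. G k j))"
    by (intro sum_mono sqnorm_off_diagonal_le fin sub nb)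
  finally show ?thesis by (simp add: sum_distrib_left)
qed

lemma column_shift:
  assumes "i \<notin> S" "K i i = 0"
  shows "schur_complement S (shift u K) G i = u - Re (ip S (\<lambda>k. K k i) (app S G (\<lambda>k. K k i)))"
    and "sqnorm S (app S G (\<lambda>k. shift u K k i)) = sqnorm S (app S G (\<lambda>k. K k i))"
proof -
  have c: "shift u K k i = - K k i" if "k \<in> S" for k
    using that assms by (auto simp: shift_def)
  have a: "app S G (\<lambda>k. shift u K k i) = (\<lambda>j. - app S G (\<lambda>k. K k i) j)"
    by (simp add: fun_eq_iff app_def c sum_negf)
  show "schur_complement S (shift u K) G i = u - Re (ip S (\<lambda>k. K k i) (app S G (\<lambda>k. K k i)))"
    using assms by (simp add: schur_complement_def a ip_def c) (simp add: shift_def)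
  show "sqnorm S (app S G (\<lambda>k. shift u K k i)) = sqnorm S (app S G (\<lambda>k. K k i))"
    by (simp add: a sqnorm_def)
qed

text \<open>What the choice of the next index \<open>i\<close> costs on one side of the spectrum. Here \<open>\<tau>\<close> is the
one-sided potential on \<open>S\<close> after the barrier has moved from \<open>u\<close> to \<open>v\<close>, and
\<open>a i = t\<^sub>i* H t\<^sub>i\<close> and \<open>b i = |H t\<^sub>i|\<^sup>2\<close> for the inverse \<open>H\<close> of \<open>v - K\<close> on \<open>S\<close>. The averages of \<open>a\<close> and \<open>b\<close> over the free indices
are small, while the index \<open>i\<close> is admissible for this side as soon as \<open>a i < v\<close>.\<close>

lemma one_sided_step:
  assumes fin: "finite I" and sub: "S \<subseteq> I" and nb: "norm_le_on I K M" and herm: "herm K"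
    and diag: "\<And>i. K i i = 0" and uv: "u < v"
    and pd: "pos_def S (shift u K)" and G: "inverse_on S (shift u K) G"
  shows "\<exists>a b \<tau>. (\<forall>i\<in>I - S. 0 \<le> a i \<and> 0 \<le> b i) \<and> (\<Sum>i\<in>I - S. a i) \<le> M\<^sup>2 * \<tau> \<and>
    (v - u) * (\<Sum>i\<in>I - S. b i) \<le> M\<^sup>2 * (trace_on S G - \<tau>) \<and>
    (\<forall>i\<in>I - S. a i < v \<longrightarrow> pos_def (insert i S) (shift v K) \<and>
       (\<exists>H. inverse_on (insert i S) (shift v K) H \<and>
         trace_on (insert i S) H = \<tau> + (1 + b i) / (v - a i)))"
proof -
  have finS: "finite S" using sub fin by (rule finite_subset)
  have pdv: "pos_def S (shift v K)"
    using pos_def_shift_mono[OF finS _ pd] uv by simp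
  obtain H h where H: "inverse_on S (shift v K) H" and gram: "gram_on S h H"
    using pos_def_inverse_exists[OF finS herm_shift[OF herm] pdv] by blast
  define a where "a i = Re (ip S (\<lambda>k. K k i) (app S H (\<lambda>k. K k i)))" for i
  define b where "b i = sqnorm S (app S H (\<lambda>k. K k i))" for i
  show ?thesis
  proof (rule exI[of _ a], rule exI[of _ b], rule exI[of _ "trace_on S H"], intro conjI ballI impI)
    show "0 \<le> a i" for i
      by (simp add: a_def gram_on_form[OF gram] sum_nonneg del: of_real_sum)
    show "0 \<le> b i" for i
      by (simp add: b_def sqnorm_nonneg)
    show "(\<Sum>i\<in>I - S. a i) \<le> M\<^sup>2 * trace_on S H"
      unfolding a_def by (rule sum_column_forms_le[OF fin sub nb herm gram])
    have "(v - u) * (\<Sum>i\<in>I - S. b i) \<le> (v - u) * (M\<^sup>2 * (\<Sum>j\<in>S. sqnorm S (\<lambda>k. H k j)))"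
      unfolding b_def using sum_column_images_le[OF fin sub nb herm gram] uv
      by (intro mult_left_mono) auto
    also have "\<dots> = M\<^sup>2 * ((v - u) * (\<Sum>j\<in>S. sqnorm S (\<lambda>k. H k j)))"
      by simp
    also have "\<dots> \<le> M\<^sup>2 * (trace_on S G - trace_on S H)"
      using trace_shift_decrease[OF finS herm pd G H uv] by (intro mult_left_mono) auto
    finally show "(v - u) * (\<Sum>i\<in>I - S. b i) \<le> M\<^sup>2 * (trace_on S G - trace_on S H)" .
    fix i assume i: "i \<in> I - S" and ai: "a i < v"
    interpret bordering S "shift v K" H h i
      using finS i herm_shift[OF herm] pdv H gram by unfold_locales auto
    have s: "schur_complement S (shift v K) H i = v - a i"
      using i by (simp add: column_shift diag a_def)
    have q: "sqnorm S (app S H (\<lambda>k. shift v K k i)) = b i"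
      using i by (simp add: column_shift diag b_def)
    show "pos_def (insert i S) (shift v K)"
      using ai by (intro pos_def_insert) (simp add: s)
    show "\<exists>H'. inverse_on (insert i S) (shift v K) H' \<and>
        trace_on (insert i S) H' = trace_on S H + (1 + b i) / (v - a i)"
      using ai inverse_on_insert trace_on_insert by (auto simp: s q)
  qed
qed

section \<open>The greedy selection of indices\<close>

text \<open>The eigenvalues of \<open>K\<close> on \<open>S\<close> lie strictly between \<open>- u\<close> and \<open>u\<close>, and the potential
\<open>tr (u - K)\<inverse> + tr (u + K)\<inverse>\<close> is at most \<open>\<phi>\<close>. One potential for both sides lets a single averaging
argument choose an index that is good for both.\<close>

definition barrier :: "('a \<Rightarrow> 'a \<Rightarrow> complex) \<Rightarrow> 'a set \<Rightarrow> real \<Rightarrow> real \<Rightarrow> bool" where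
  "barrier K S u \<phi> \<longleftrightarrow> (\<exists>G H. pos_def S (shift u K) \<and> pos_def S (shift u (\<lambda>i j. - K i j))
     \<and> inverse_on S (shift u K) G \<and> inverse_on S (shift u (\<lambda>i j. - K i j)) H
     \<and> trace_on S G + trace_on S H \<le> \<phi>)"

lemma add_reciprocals_le:
  fixes a a' b b' v :: real
  assumes "0 \<le> a" "0 \<le> a'" "0 \<le> b" "0 \<le> b'" "a + a' < v"
  shows "(1 + b) / (v - a) + (1 + b') / (v - a') \<le> (2 + (b + b')) / (v - (a + a'))"
proof -
  have "(1 + b) / (v - a) \<le> (1 + b) / (v - (a + a'))"
    using assms by (intro divide_left_mono) auto
  moreover have "(1 + b') / (v - a') \<le> (1 + b') / (v - (a + a'))"
    using assms by (intro divide_left_mono) auto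
  ultimately show ?thesis by (simp add: add_divide_distrib)
qed

text \<open>Let \<open>D\<close> be the potential that is freed by moving the barrier, and let \<open>a\<close> and \<open>b\<close> be the quantities of
lemma \<open>one_sided_step\<close>, added over both sides. An index with
\<open>2 + b i \<le> (D + c) (v - a i)\<close> raises the potential by at most \<open>D + c\<close> after the move, that is by at
most \<open>c\<close> in total. Such an index exists because the inequality holds on average over the free
indices: the sum of the \<open>b i\<close> is at most \<open>M\<^sup>2 D / (v - u)\<close>, and the last two hypotheses, on
\<open>N v - M\<^sup>2 \<phi>\<close>, where \<open>N\<close> is the number of free indices, make room for \<open>b i\<close> and for \<open>2\<close>.\<close>

lemma barrier_step:
  assumes fin: "finite I" and sub: "S \<subseteq> I" and nb: "norm_le_on I K M" and herm: "herm K"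
    and diag: "\<And>i. K i i = 0" and uv: "u < v" and M: "0 < M" and c: "0 < c"
    and bar: "barrier K S u \<phi>"
    and W1: "M\<^sup>2 \<le> (v - u) * (real (card (I - S)) * v - M\<^sup>2 * \<phi>)"
    and W2: "2 * real (card (I - S)) \<le> c * (real (card (I - S)) * v - M\<^sup>2 * \<phi>)"
  shows "\<exists>i\<in>I - S. barrier K (insert i S) v (\<phi> + c)"
proof -
  let ?N = "\<lambda>i j. - K i j"
  define W where "W = real (card (I - S)) * v - M\<^sup>2 * \<phi>"
  obtain G H where pd: "pos_def S (shift u K)" "pos_def S (shift u ?N)"
    and inv: "inverse_on S (shift u K) G" "inverse_on S (shift u ?N) H"
    and tr: "trace_on S G + trace_on S H \<le> \<phi>"
    using bar by (auto simp: barrier_def)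
  have nbN: "norm_le_on I ?N M"
    using nb by (simp add: norm_le_on_def app_def sqnorm_def sum_negf)
  have hermN: "herm ?N" using herm by (simp add: herm_def)
  have diagN: "- K i i = 0" for i using diag by simp
  obtain a b \<tau> where 1: "\<forall>i\<in>I - S. 0 \<le> a i \<and> 0 \<le> b i"
    "(\<Sum>i\<in>I - S. a i) \<le> M\<^sup>2 * \<tau>" "(v - u) * (\<Sum>i\<in>I - S. b i) \<le> M\<^sup>2 * (trace_on S G - \<tau>)"
    "\<forall>i\<in>I - S. a i < v \<longrightarrow> pos_def (insert i S) (shift v K) \<and>
       (\<exists>H. inverse_on (insert i S) (shift v K) H \<and>
         trace_on (insert i S) H = \<tau> + (1 + b i) / (v - a i))"
    by (rule exE[OF one_sided_step[OF fin sub nb herm diag uv pd(1) inv(1)]]) blast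
  obtain a' b' \<tau>' where 2: "\<forall>i\<in>I - S. 0 \<le> a' i \<and> 0 \<le> b' i"
    "(\<Sum>i\<in>I - S. a' i) \<le> M\<^sup>2 * \<tau>'" "(v - u) * (\<Sum>i\<in>I - S. b' i) \<le> M\<^sup>2 * (trace_on S H - \<tau>')"
    "\<forall>i\<in>I - S. a' i < v \<longrightarrow> pos_def (insert i S) (shift v ?N) \<and>
       (\<exists>H. inverse_on (insert i S) (shift v ?N) H \<and>
         trace_on (insert i S) H = \<tau>' + (1 + b' i) / (v - a' i))"
    by (rule exE[OF one_sided_step[OF fin sub nbN hermN diagN uv pd(2) inv(2)]]) blast
  define D where "D = trace_on S G + trace_on S H - (\<tau> + \<tau>')"
  have bD: "(v - u) * (\<Sum>i\<in>I - S. b i + b' i) \<le> M\<^sup>2 * D"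
    using 1(3) 2(3) by (simp add: D_def sum.distrib algebra_simps)
  have "0 \<le> (\<Sum>i\<in>I - S. b i + b' i)"
    using 1(1) 2(1) by (intro sum_nonneg add_nonneg_nonneg) auto
  then have "0 \<le> M\<^sup>2 * D" using bD uv by (smt (verit) mult_nonneg_nonneg)
  then have D: "0 \<le> D" using M by (simp add: zero_le_mult_iff)
  have W: "0 < W"
  proof -
    have "0 < M\<^sup>2" using M by simp
    then have "0 < (v - u) * W" using W1 unfolding W_def by linarith
    then show ?thesis using uv by (simp add: zero_less_mult_iff)
  qed
  have sumb: "(\<Sum>i\<in>I - S. b i + b' i) \<le> D * W"
  proof -
    have "(v - u) * (\<Sum>i\<in>I - S. b i + b' i) \<le> M\<^sup>2 * D" by (rule bD)
    also have "\<dots> \<le> ((v - u) * W) * D" using W1 D unfolding W_def by (intro mult_right_mono) auto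
    finally have "(v - u) * (\<Sum>i\<in>I - S. b i + b' i) \<le> (v - u) * (D * W)" by (simp add: mult_ac)
    then show ?thesis using uv by simp
  qed
  have suma: "W \<le> (\<Sum>i\<in>I - S. v - (a i + a' i))"
  proof -
    have "(\<Sum>i\<in>I - S. a i + a' i) \<le> M\<^sup>2 * (\<tau> + \<tau>')"
      using 1(2) 2(2) by (simp add: sum.distrib algebra_simps)
    also have "\<dots> \<le> M\<^sup>2 * \<phi>"
      using D tr by (intro mult_left_mono) (auto simp: D_def)
    finally show ?thesis by (simp add: W_def sum_subtractf)
  qed
  have "(\<Sum>i\<in>I - S. 2 + (b i + b' i)) = 2 * real (card (I - S)) + (\<Sum>i\<in>I - S. b i + b' i)"
    by (simp add: sum.distrib)
  also have "\<dots> \<le> c * W + D * W"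
    using W2 sumb unfolding W_def by linarith
  also have "\<dots> = (D + c) * W" by (simp add: algebra_simps)
  also have "\<dots> \<le> (D + c) * (\<Sum>i\<in>I - S. v - (a i + a' i))"
    using suma D c by (intro mult_left_mono) auto
  finally have le: "(\<Sum>i\<in>I - S. 2 + (b i + b' i)) \<le> (\<Sum>i\<in>I - S. (D + c) * (v - (a i + a' i)))"
    by (simp only: sum_distrib_left)
  have ne: "I - S \<noteq> {}"
    using suma W by (metis sum.empty less_le_not_le)
  have "\<exists>i\<in>I - S. 2 + (b i + b' i) \<le> (D + c) * (v - (a i + a' i))"
  proof (rule ccontr)
    assume "\<not> ?thesis"
    then have "(\<Sum>i\<in>I - S. (D + c) * (v - (a i + a' i))) < (\<Sum>i\<in>I - S. 2 + (b i + b' i))"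
      using fin ne by (intro sum_strict_mono) (auto simp: not_le)
    then show False using le by linarith
  qed
  then obtain i where i: "i \<in> I - S" and ile: "2 + (b i + b' i) \<le> (D + c) * (v - (a i + a' i))"
    by blast
  have nn: "0 \<le> a i" "0 \<le> b i" "0 \<le> a' i" "0 \<le> b' i" using 1(1) 2(1) i by auto
  have "0 < (D + c) * (v - (a i + a' i))" using ile nn by linarith
  then have av: "a i + a' i < v" using D c by (simp add: zero_less_mult_iff)
  obtain G' where G': "pos_def (insert i S) (shift v K)" "inverse_on (insert i S) (shift v K) G'"
    "trace_on (insert i S) G' = \<tau> + (1 + b i) / (v - a i)"
    using bspec[OF 1(4) i] av nn by auto
  obtain H' where H': "pos_def (insert i S) (shift v ?N)" "inverse_on (insert i S) (shift v ?N) H'"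
    "trace_on (insert i S) H' = \<tau>' + (1 + b' i) / (v - a' i)"
    using bspec[OF 2(4) i] av nn by auto
  have "(2 + (b i + b' i)) / (v - (a i + a' i)) \<le> D + c"
    using ile av by (simp add: pos_divide_le_eq)
  then have "trace_on (insert i S) G' + trace_on (insert i S) H' \<le> \<phi> + c"
    using add_reciprocals_le[of "a i" "a' i" "b i" "b' i" v] nn av tr G'(3) H'(3)
    by (simp add: D_def)
  then show ?thesis
    using i G'(1,2) H'(1,2) unfolding barrier_def by blast
qed

lemma barrier_singleton:
  assumes "K i i = 0" "0 < u"
  shows "barrier K {i} u (2 / u)"
proof -
  have "pos_def {i} (shift u L)" "inverse_on {i} (shift u L) (\<lambda>_ _. 1 / of_real u)"
    if "L i i = 0" for L
    using that assms(2)
  proof -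
    have "cnj z * (of_real u * z) = of_real (u * (cmod z)\<^sup>2)" for z
      by (metis cnj_mult_self mult.left_commute of_real_mult)
    then show "pos_def {i} (shift u L)"
      using that assms(2) by (simp add: pos_def_def ip_def app_def shift_def del: of_real_mult)
    show "inverse_on {i} (shift u L) (\<lambda>_ _. 1 / of_real u)"
      using that assms(2) by (simp add: app_def shift_def inverse_on_def)
  qed
  moreover have "trace_on {i} (\<lambda>_ _. 1 / of_real u) = 1 / u"
    by (simp add: trace_on_def Re_divide_of_real)
  ultimately show ?thesis
    unfolding barrier_def using assms(1)
    by (intro exI[of _ "\<lambda>_ _. 1 / of_real u"]) auto
qed

text \<open>For a Hermitian kernel the norm equals the numerical radius: polarize \<open>Re \<langle>y, K x\<rangle>\<close> at
\<open>y = K x / u\<close> and use the parallelogram law.\<close>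

lemma barrier_norm_le:
  assumes fin: "finite S" and herm: "herm K" and u: "0 < u" and bar: "barrier K S u \<phi>"
  shows "norm_le_on S K u"
  unfolding norm_le_on_def
proof
  fix x
  define q where "q z = Re (ip S z (app S K z))" for z
  have up: "q z \<le> u * sqnorm S z" and lo: "- (u * sqnorm S z) \<le> q z" for z
  proof -
    have "pos_def S (shift u K)" "pos_def S (shift u (\<lambda>i j. - K i j))"
      using bar by (auto simp: barrier_def)
    note nn = this[THEN pos_def_nonneg, of z]
    have "ip S z (app S (\<lambda>i j. - K i j) z) = - ip S z (app S K z)"
      by (simp add: ip_def app_def sum_negf)
    with nn show "q z \<le> u * sqnorm S z" "- (u * sqnorm S z) \<le> q z"
      by (simp_all add: ip_app_shift[OF fin] ip_self q_def)
  qed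
  define y where "y = (\<lambda>i. app S K x i / of_real u)"
  let ?p = "\<lambda>i. x i + y i" and ?m = "\<lambda>i. x i - y i"
  have app_pm: "app S K ?p i = app S K x i + app S K y i" "app S K ?m i = app S K x i - app S K y i" for i
    by (simp_all add: app_def distrib_left right_diff_distrib sum.distrib sum_subtractf)
  have sw: "Re (ip S x (app S K y)) = Re (ip S y (app S K x))"
    by (metis cnj_ip ip_app_herm[OF herm] cnj.simps(1))
  have "ip S ?p (app S K ?p) - ip S ?m (app S K ?m)
     = 2 * ip S x (app S K y) + 2 * ip S y (app S K x)"
    by (simp add: ip_def app_pm algebra_simps sum.distrib sum_subtractf sum_distrib_left)
  then have "q ?p - q ?m = Re (2 * ip S x (app S K y) + 2 * ip S y (app S K x))"
    unfolding q_def by (simp only: flip: minus_complex.sel(1))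
  then have "q ?p - q ?m = 4 * Re (ip S y (app S K x))"
    using sw by simp
  moreover have "ip S y (app S K x) = of_real (sqnorm S (app S K x) / u)"
    by (simp add: y_def ip_def sqnorm_def sum_divide_distrib cnj_mult_self)
  moreover have "sqnorm S ?p + sqnorm S ?m = 2 * sqnorm S x + 2 * sqnorm S y"
  proof -
    have "(cmod (z + w))\<^sup>2 + (cmod (z - w))\<^sup>2 = 2 * (cmod z)\<^sup>2 + 2 * (cmod w)\<^sup>2" for z w :: complex
      unfolding cmod_power2 by (simp add: power2_eq_square algebra_simps)
    then have "sqnorm S ?p + sqnorm S ?m = (\<Sum>i\<in>S. 2 * (cmod (x i))\<^sup>2 + 2 * (cmod (y i))\<^sup>2)"
      unfolding sqnorm_def sum.distrib[symmetric] by (intro sum.cong refl)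
    then show ?thesis by (simp only: sqnorm_def sum.distrib sum_distrib_left)
  qed
  moreover have "sqnorm S y = sqnorm S (app S K x) / u\<^sup>2"
    using u by (simp add: y_def sqnorm_def norm_divide power_divide sum_divide_distrib)
  moreover have "q ?p - q ?m \<le> u * (sqnorm S ?p + sqnorm S ?m)"
    using up[of ?p] lo[of ?m] by (simp only: distrib_left)
  ultimately have "4 * (sqnorm S (app S K x) / u)
      \<le> u * (2 * sqnorm S x + 2 * (sqnorm S (app S K x) / u\<^sup>2))"
    by (simp only: Re_complex_of_real)
  then have "2 * (sqnorm S (app S K x) / u) \<le> 2 * (u * sqnorm S x)"
    using u by (simp add: distrib_left power2_eq_square)
  then show "sqnorm S (app S K x) \<le> u\<^sup>2 * sqnorm S x"
    using u by (simp add: pos_divide_le_eq power2_eq_square mult_ac)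
qed


lemma barrier_mono: "barrier K S u \<phi> \<Longrightarrow> \<phi> \<le> \<psi> \<Longrightarrow> barrier K S u \<psi>"
  unfolding barrier_def by (meson order_trans)

text \<open>With \<open>E = e M\<close> and \<open>n = |I|\<close>, the barrier starts at \<open>E / 2\<close> and moves by \<open>8 M\<^sup>2 / (n E)\<close> in each step,
while the potential grows by \<open>8 / E\<close>. As long as \<open>k \<le> e\<^sup>2 n / 64\<close>, at least half of the indices are
free and \<open>M\<^sup>2 \<phi> \<le> n E / 8\<close>, at most half of \<open>N v \<ge> n E / 4\<close>; this is what the step requires. The set
has \<open>k + 1\<close> elements, since a singleton already satisfies the initial bounds; so the size is never
lost to rounding down.\<close>

lemma greedy_barrier:
  fixes K :: "'a \<Rightarrow> 'a \<Rightarrow> complex"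
  assumes fin: "finite I" and ne: "I \<noteq> {}" and nb: "norm_le_on I K M" and herm: "herm K"
    and diag: "\<And>i. K i i = 0" and M: "0 < M" and e: "0 < e" "e < 1"
    and k: "real k \<le> e\<^sup>2 * real (card I) / 64"
  shows "\<exists>S\<subseteq>I. card S = Suc k \<and>
    barrier K S (e * M / 2 + real k * (8 * M / (e * real (card I)))) (8 * (real k + 1) / (e * M))"
  using k
proof (induction k)
  case 0
  obtain i where i: "i \<in> I" using ne by blast
  have "barrier K {i} (e * M / 2) (2 / (e * M / 2))"
    using diag e M by (intro barrier_singleton) auto
  then have "barrier K {i} (e * M / 2) (8 / (e * M))"
    by (rule barrier_mono) (use e M in \<open>simp add: divide_right_mono\<close>)
  then show ?case using i by (intro exI[of _ "{i}"]) simp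
next
  case (Suc k)
  define n E \<delta> where "n = real (card I)" and "E = e * M" and "\<delta> = 8 * M / (e * n)"
  define u v \<phi> where "u = E / 2 + real k * \<delta>" and "v = E / 2 + real (Suc k) * \<delta>"
    and "\<phi> = 8 * (real k + 1) / E"
  have n: "0 < n" using fin ne by (simp add: n_def card_gt_0_iff)
  have E: "0 < E" and \<delta>: "0 < \<delta>" using e M n by (simp_all add: E_def \<delta>_def)
  have kle: "real (Suc k) \<le> e\<^sup>2 * n / 64" using Suc.prems by (simp add: n_def)
  then have "real k \<le> e\<^sup>2 * n / 64" by simp
  then obtain S where S: "S \<subseteq> I" "card S = Suc k" and bar: "barrier K S u \<phi>"
    using Suc.IH by (auto simp: n_def E_def \<delta>_def u_def \<phi>_def)
  define N where "N = real (card (I - S))"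
  have "e\<^sup>2 < 1" using e by (simp add: power_less_one_iff abs_square_less_1)
  then have "e\<^sup>2 * n < n" using n by simp
  moreover have "N = n - real (Suc k)"
  proof -
    have "Suc k \<le> card I" using card_mono[OF fin S(1)] S(2) by simp
    then show ?thesis
      using S fin by (simp add: N_def n_def card_Diff_subset finite_subset of_nat_diff)
  qed
  ultimately have N: "n / 2 \<le> N" using kle n by linarith
  have v: "E / 2 \<le> v" using \<delta> by (simp add: v_def)
  have Nv: "n * E / 4 \<le> N * v"
    using mult_mono[OF N v] N n E by simp
  have "M\<^sup>2 * \<phi> = 8 * M\<^sup>2 / E * real (Suc k)"
    by (simp add: \<phi>_def)
  also have "\<dots> \<le> 8 * M\<^sup>2 / E * (e\<^sup>2 * n / 64)"
    using kle E by (intro mult_left_mono) auto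
  also have "\<dots> = n * E / 8"
    using E by (simp add: E_def power2_eq_square)
  finally have M\<phi>: "M\<^sup>2 * \<phi> \<le> n * E / 8" .
  have "M\<^sup>2 = \<delta> * (n * E / 8)"
    using e n by (simp add: \<delta>_def E_def power2_eq_square)
  also have "\<dots> \<le> \<delta> * (N * v - M\<^sup>2 * \<phi>)"
    using Nv M\<phi> \<delta> by (intro mult_left_mono) auto
  also have "\<delta> = v - u" by (simp add: u_def v_def algebra_simps)
  finally have W1: "M\<^sup>2 \<le> (v - u) * (N * v - M\<^sup>2 * \<phi>)" .
  have "2 * N = 8 / E * (N * (E / 2) / 2)" using E by simp
  also have "\<dots> \<le> 8 / E * (N * v / 2)"
    using v N n E by (intro mult_left_mono divide_right_mono) auto
  also have "\<dots> \<le> 8 / E * (N * v - M\<^sup>2 * \<phi>)"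
    using Nv M\<phi> E by (intro mult_left_mono) auto
  finally have W2: "2 * N \<le> 8 / E * (N * v - M\<^sup>2 * \<phi>)" .
  have "u < v" using \<delta> by (simp add: u_def v_def)
  then obtain i where i: "i \<in> I - S" and "barrier K (insert i S) v (\<phi> + 8 / E)"
    using barrier_step[OF fin S(1) nb herm diag _ M _ bar, of v "8 / E"] W1 W2 E
    unfolding N_def by auto
  moreover have "\<phi> + 8 / E = 8 * (real (Suc k) + 1) / E"
    by (simp add: \<phi>_def add_divide_distrib)
  moreover have "card (insert i S) = Suc (Suc k)"
    using i S finite_subset[OF S(1) fin] by simp
  ultimately show ?case
    using S i unfolding v_def \<delta>_def E_def n_def by (intro exI[of _ "insert i S"]) auto
qed

text \<open>After \<open>k = \<lfloor>e\<^sup>2 n / 64\<rfloor>\<close> steps the barrier has moved by at most \<open>e M / 8\<close>, so it still lies below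
\<open>e M\<close>.\<close>

theorem kernel_restriction:
  fixes K :: "'a \<Rightarrow> 'a \<Rightarrow> complex"
  assumes fin: "finite I" and nb: "norm_le_on I K M" and herm: "herm K"
    and diag: "\<And>i. K i i = 0" and M: "0 \<le> M" and e: "0 < e" "e < 1"
  shows "\<exists>S\<subseteq>I. e\<^sup>2 * real (card I) / 64 \<le> real (card S) \<and> norm_le_on S K (e * M)"
proof (cases "I = {} \<or> M = 0")
  case True
  \<comment> \<open>If \<open>M = 0\<close>, then \<open>K\<close> vanishes on \<open>I\<close>, and all of \<open>I\<close> can be taken.\<close>
  have "e\<^sup>2 \<le> 1" using e by (simp add: power_le_one)
  then have "e\<^sup>2 * real (card I) \<le> real (card I)" by (simp add: mult_left_le_one_le)
  then have "e\<^sup>2 * real (card I) / 64 \<le> real (card I)" by simp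
  moreover have "norm_le_on I K (e * M)"
    using True nb by (auto simp: norm_le_on_def sqnorm_def)
  ultimately show ?thesis by blast
next
  case False
  then have ne: "I \<noteq> {}" and M0: "0 < M" using M by auto
  define n k where "n = real (card I)" and "k = nat \<lfloor>e\<^sup>2 * n / 64\<rfloor>"
  have n: "0 < n" using fin ne by (simp add: n_def card_gt_0_iff)
  have k: "real k \<le> e\<^sup>2 * n / 64" "e\<^sup>2 * n / 64 < real k + 1"
    unfolding k_def using n e by (intro of_nat_floor, simp, linarith)
  obtain S where S: "S \<subseteq> I" "card S = Suc k"
    and bar: "barrier K S (e * M / 2 + real k * (8 * M / (e * n))) (8 * (real k + 1) / (e * M))"
    using greedy_barrier[OF fin ne nb herm diag M0 e, of k] k(1) unfolding n_def by blast
  let ?u = "e * M / 2 + real k * (8 * M / (e * n))"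
  have "0 < ?u" using e M0 n by (simp add: add_pos_nonneg)
  then have "norm_le_on S K ?u"
    using barrier_norm_le[OF finite_subset[OF S(1) fin] herm _ bar] by blast
  moreover have "?u \<le> e * M"
  proof -
    have "real k * (8 * M / (e * n)) \<le> e\<^sup>2 * n / 64 * (8 * M / (e * n))"
      using k(1) e M0 n by (intro mult_right_mono) auto
    also have "\<dots> = e * M / 8" using e n by (simp add: power2_eq_square)
    also have "\<dots> \<le> e * M / 2" using e M0 by simp
    finally show ?thesis by simp
  qed
  ultimately have "norm_le_on S K (e * M)"
    using \<open>0 < ?u\<close> unfolding norm_le_on_def
    by (meson less_imp_le mult_right_mono order_trans power_mono sqnorm_nonneg)
  moreover have "e\<^sup>2 * real (card I) / 64 \<le> real (card S)"
    using k(2) S(2) by (simp add: n_def)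
  ultimately show ?thesis using S(1) by blast
qed

section \<open>From kernels to matrices\<close>

lemma vec_l2_norm_mult_le_op_norm:
  assumes v: "v \<in> carrier_vec (dim_col A)"
  shows "vec_l2_norm (A *\<^sub>v v) \<le> mat_op_norm A * vec_l2_norm v"
proof (cases "vec_l2_norm v = 0")
  case True
  then show ?thesis using vec_l2_norm_mult_le[OF v] by simp
next
  case False
  define r where "r = vec_l2_norm v"
  have r: "0 < r" using False by (simp add: r_def vec_l2_norm_def L2_set_nonneg less_le)
  have scale: "vec_l2_norm (complex_of_real (1 / r) \<cdot>\<^sub>v w) = vec_l2_norm w / r" for w
  proof -
    have "vec_l2_norm (complex_of_real (1 / r) \<cdot>\<^sub>v w)
        = L2_set (\<lambda>i. 1 / r * cmod (w $ i)) {..<dim_vec w}"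
      unfolding vec_l2_norm_def using r by (intro L2_set_cong) (auto simp: norm_divide)
    also have "\<dots> = 1 / r * vec_l2_norm w"
      unfolding vec_l2_norm_def using r by (intro L2_set_right_distrib[symmetric]) simp
    finally show ?thesis by simp
  qed
  let ?w = "complex_of_real (1 / r) \<cdot>\<^sub>v v"
  have "?w \<in> {v \<in> carrier_vec (dim_col A). vec_l2_norm v \<le> 1}"
    using v r False by (simp only: mem_Collect_eq scale) (simp add: r_def)
  then have "vec_l2_norm (A *\<^sub>v ?w) \<le> mat_op_norm A"
    unfolding mat_op_norm_def by (rule cSUP_upper[OF _ bdd_above_mat_op_norm])
  moreover have "A *\<^sub>v ?w = complex_of_real (1 / r) \<cdot>\<^sub>v (A *\<^sub>v v)"
    using v by (intro mult_mat_vec) auto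
  ultimately have "vec_l2_norm (A *\<^sub>v v) / r \<le> mat_op_norm A" by (simp only: scale)
  then show ?thesis using r by (simp add: pos_divide_le_eq r_def)
qed

lemma mat_op_norm_nonneg: "0 \<le> mat_op_norm A"
proof -
  have "0\<^sub>v (dim_col A) \<in> {v \<in> carrier_vec (dim_col A). vec_l2_norm v \<le> 1}"
    by (simp add: vec_l2_norm_def L2_set_def)
  then have "vec_l2_norm (A *\<^sub>v 0\<^sub>v (dim_col A)) \<le> mat_op_norm A"
    unfolding mat_op_norm_def by (rule cSUP_upper[OF _ bdd_above_mat_op_norm])
  moreover have "0 \<le> vec_l2_norm w" for w by (simp add: vec_l2_norm_def L2_set_nonneg)
  ultimately show ?thesis by (meson order_trans)
qed

lemma mat_op_norm_leI:
  assumes "\<And>v. v \<in> carrier_vec (dim_col A) \<Longrightarrow> vec_l2_norm (A *\<^sub>v v) \<le> c * vec_l2_norm v" "0 \<le> c"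
  shows "mat_op_norm A \<le> c"
  unfolding mat_op_norm_def
proof (rule cSUP_least)
  have "0\<^sub>v (dim_col A) \<in> {v \<in> carrier_vec (dim_col A). vec_l2_norm v \<le> 1}"
    by (simp add: vec_l2_norm_def L2_set_def)
  then show "{v \<in> carrier_vec (dim_col A). vec_l2_norm v \<le> 1} \<noteq> {}" by blast
  fix v assume v: "v \<in> {v \<in> carrier_vec (dim_col A). vec_l2_norm v \<le> 1}"
  then have "vec_l2_norm (A *\<^sub>v v) \<le> c * vec_l2_norm v" using assms(1) by simp
  also have "\<dots> \<le> c" using v assms(2) by (simp add: mult_left_le)
  finally show "vec_l2_norm (A *\<^sub>v v) \<le> c" .
qed

lemma vec_l2_norm_sq: "(vec_l2_norm v)\<^sup>2 = sqnorm {..<dim_vec v} (($) v)"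
  by (simp add: vec_l2_norm_def sqnorm_def L2_set_def sum_nonneg)

text \<open>Extension by zero carries the symmetry and the zero diagonal of \<open>T\<close> over to all indices, not only
those below the dimension.\<close>

definition mat_kernel :: "complex mat \<Rightarrow> nat \<Rightarrow> nat \<Rightarrow> complex" where
  "mat_kernel T i j = (if i < dim_row T \<and> j < dim_col T then T $$ (i, j) else 0)"

lemma norm_le_on_mat_kernel:
  assumes T: "T \<in> carrier_mat n n"
  shows "norm_le_on {..<n} (mat_kernel T) (mat_op_norm T)"
  unfolding norm_le_on_def
proof
  fix x :: "nat \<Rightarrow> complex"
  have v: "vec n x \<in> carrier_vec (dim_col T)" using T by simp
  have ap: "app {..<n} (mat_kernel T) x i = (T *\<^sub>v vec n x) $ i" if "i < n" for i
    using T that by (simp add: app_def mat_kernel_def scalar_prod_def atLeast0LessThan)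
  have "sqnorm {..<n} (app {..<n} (mat_kernel T) x) = (vec_l2_norm (T *\<^sub>v vec n x))\<^sup>2"
    unfolding vec_l2_norm_sq using T by (simp add: sqnorm_def ap del: index_mult_mat_vec)
  also have "\<dots> \<le> (mat_op_norm T * vec_l2_norm (vec n x))\<^sup>2"
    by (intro power_mono vec_l2_norm_mult_le_op_norm[OF v])
       (simp add: vec_l2_norm_def L2_set_nonneg)
  also have "\<dots> = (mat_op_norm T)\<^sup>2 * sqnorm {..<n} x"
    unfolding power_mult_distrib vec_l2_norm_sq by (simp add: sqnorm_def)
  finally show "sqnorm {..<n} (app {..<n} (mat_kernel T) x) \<le> (mat_op_norm T)\<^sup>2 * sqnorm {..<n} x" .
qed

text \<open>Principal submatrices list their indices through \<open>pick\<close>; this turns sums over positions into sums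
over the indices themselves.\<close>

lemma bij_betw_pick:
  assumes "finite \<sigma>"
  shows "bij_betw (pick \<sigma>) {..<card \<sigma>} \<sigma>"
proof (rule bij_betw_imageI)
  show inj: "inj_on (pick \<sigma>) {..<card \<sigma>}"
    by (rule inj_onI) (metis card_pick lessThan_iff pick_eq_iff_inf)
  have "pick \<sigma> ` {..<card \<sigma>} \<subseteq> \<sigma>"
    using pick_in_set_le by auto
  then show "pick \<sigma> ` {..<card \<sigma>} = \<sigma>"
    using assms inj by (intro card_subset_eq) (auto simp: card_image)
qed

lemma mat_op_norm_submatrix_le:
  assumes T: "T \<in> carrier_mat n n" and \<sigma>: "\<sigma> \<subseteq> {..<n}" and c: "0 \<le> c"
    and nb: "norm_le_on \<sigma> (mat_kernel T) c"
  shows "mat_op_norm (submatrix T \<sigma> \<sigma>) \<le> c"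
proof (rule mat_op_norm_leI[OF _ c])
  have fin: "finite \<sigma>" using \<sigma> finite_subset by blast
  have eq: "{i. i < n \<and> i \<in> \<sigma>} = \<sigma>" using \<sigma> by auto
  have dims: "dim_row (submatrix T \<sigma> \<sigma>) = card \<sigma>" "dim_col (submatrix T \<sigma> \<sigma>) = card \<sigma>"
    using T by (simp_all add: dim_submatrix eq)
  have bij: "bij_betw (pick \<sigma>) {..<card \<sigma>} \<sigma>" by (rule bij_betw_pick[OF fin])
  have reindex: "(\<Sum>i\<in>\<sigma>. f i) = (\<Sum>i<card \<sigma>. f (pick \<sigma> i))" for f :: "nat \<Rightarrow> 'b::comm_monoid_add"
    by (rule sum.reindex_bij_betw[OF bij, symmetric])
  fix v :: "complex vec" assume "v \<in> carrier_vec (dim_col (submatrix T \<sigma> \<sigma>))"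
  then have v: "dim_vec v = card \<sigma>" by (simp add: dims)
  define x where "x j = v $ (the_inv_into {..<card \<sigma>} (pick \<sigma>) j)" for j
  have x: "x (pick \<sigma> i) = v $ i" if "i < card \<sigma>" for i
    using that bij by (simp add: x_def the_inv_into_f_f bij_betw_def)
  have lt: "pick \<sigma> i < n" if "i < card \<sigma>" for i
    using pick_in_set_le[OF that] \<sigma> by auto
  have ap: "(submatrix T \<sigma> \<sigma> *\<^sub>v v) $ i = app \<sigma> (mat_kernel T) x (pick \<sigma> i)" if i: "i < card \<sigma>" for i
  proof -
    have "(submatrix T \<sigma> \<sigma> *\<^sub>v v) $ i = (\<Sum>j<card \<sigma>. submatrix T \<sigma> \<sigma> $$ (i, j) * v $ j)"
      using i v by (simp add: dims scalar_prod_def atLeast0LessThan)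
    also have "\<dots> = (\<Sum>j<card \<sigma>. mat_kernel T (pick \<sigma> i) (pick \<sigma> j) * x (pick \<sigma> j))"
      using T i by (intro sum.cong refl) (simp add: submatrix_index eq mat_kernel_def lt x)
    finally show ?thesis by (simp add: app_def reindex)
  qed
  have "(vec_l2_norm (submatrix T \<sigma> \<sigma> *\<^sub>v v))\<^sup>2 = sqnorm \<sigma> (app \<sigma> (mat_kernel T) x)"
    by (simp add: vec_l2_norm_sq sqnorm_def reindex dims ap del: index_mult_mat_vec)
  also have "\<dots> \<le> c\<^sup>2 * sqnorm \<sigma> x"
    using nb by (simp add: norm_le_on_def)
  also have "sqnorm \<sigma> x = (vec_l2_norm v)\<^sup>2"
    by (simp add: vec_l2_norm_sq sqnorm_def reindex x v)
  finally have "(vec_l2_norm (submatrix T \<sigma> \<sigma> *\<^sub>v v))\<^sup>2 \<le> (c * vec_l2_norm v)\<^sup>2"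
    by (simp add: power_mult_distrib)
  then show "vec_l2_norm (submatrix T \<sigma> \<sigma> *\<^sub>v v) \<le> c * vec_l2_norm v"
    by (rule power2_le_imp_le) (simp add: c vec_l2_norm_def L2_set_nonneg)
qed

text \<open>The stated constant is \<open>(17 - 12 sqrt 2) / 2\<close>, about \<open>0.0147\<close>, slightly below the \<open>1 / 64\<close> that the
greedy selection achieves.\<close>

lemma sqrt2_const_le: "(sqrt 2 - 1) ^ 4 / 2 \<le> 1 / (64 :: real)"
proof -
  have "(sqrt 2 - 1) ^ 4 = ((sqrt 2 - 1)\<^sup>2)\<^sup>2" by simp
  also have "(sqrt 2 - 1)\<^sup>2 = 3 - 2 * sqrt 2" by (simp add: power2_diff)
  also have "(3 - 2 * sqrt 2)\<^sup>2 = 17 - 12 * sqrt 2" by (simp add: power2_diff power_mult_distrib)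
  finally have "(sqrt 2 - 1) ^ 4 = 17 - 12 * sqrt 2" .
  moreover have "14142 / 10000 \<le> sqrt (2 :: real)"
    by (rule real_le_rsqrt) (simp add: power2_eq_square)
  ultimately show ?thesis by simp
qed

theorem proposition5p1:
  fixes n :: nat and T :: "complex mat" and \<epsilon> :: real
  assumes "T \<in> carrier_mat n n"
    and "hermitian_mat T"
    and "\<And>i. i < n \<Longrightarrow> T $$ (i, i) = 0"
    and "0 < \<epsilon>" and "\<epsilon> < 1"
  shows "\<exists>\<sigma>. \<sigma> \<subseteq> {..<n}
    \<and> real (card \<sigma>) \<ge> (sqrt 2 - 1) ^ 4 * \<epsilon>\<^sup>2 * real n / 2
    \<and> mat_op_norm (coord_proj n \<sigma> * T * mat_adjoint (coord_proj n \<sigma>)) \<le> \<epsilon> * mat_op_norm T"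
proof -
  have herm: "herm (mat_kernel T)"
    unfolding herm_def
  proof (intro allI)
    fix i j
    show "cnj (mat_kernel T i j) = mat_kernel T j i"
    proof (cases "i < n \<and> j < n")
      case True
      then have "mat_adjoint T $$ (j, i) = cnj (T $$ (i, j))"
        using assms(1) by (simp add: mat_adjoint_index)
      then show ?thesis
        using True assms(1,2) by (simp add: mat_kernel_def hermitian_mat_def)
    qed (use assms(1) in \<open>auto simp: mat_kernel_def\<close>)
  qed
  have diag: "mat_kernel T i i = 0" for i
    using assms(1,3) by (simp add: mat_kernel_def)
  obtain \<sigma> where \<sigma>: "\<sigma> \<subseteq> {..<n}" and card: "\<epsilon>\<^sup>2 * real n / 64 \<le> real (card \<sigma>)"
    and nb: "norm_le_on \<sigma> (mat_kernel T) (\<epsilon> * mat_op_norm T)"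
    using kernel_restriction[OF _ norm_le_on_mat_kernel[OF assms(1)] herm diag mat_op_norm_nonneg
        assms(4,5)] by auto
  have "(sqrt 2 - 1) ^ 4 * \<epsilon>\<^sup>2 * real n / 2 = (sqrt 2 - 1) ^ 4 / 2 * (\<epsilon>\<^sup>2 * real n)" by simp
  also have "\<dots> \<le> 1 / 64 * (\<epsilon>\<^sup>2 * real n)"
    by (intro mult_right_mono sqrt2_const_le) simp
  finally have "(sqrt 2 - 1) ^ 4 * \<epsilon>\<^sup>2 * real n / 2 \<le> real (card \<sigma>)"
    using card by linarith
  moreover have "mat_op_norm (coord_proj n \<sigma> * T * mat_adjoint (coord_proj n \<sigma>)) \<le> \<epsilon> * mat_op_norm T"
    unfolding compression_eq_submatrix[OF assms(1) \<sigma>]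
    using assms(4) by (intro mat_op_norm_submatrix_le[OF assms(1) \<sigma> _ nb])
      (simp add: mat_op_norm_nonneg)
  ultimately show ?thesis using \<sigma> by blast
qed

end
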